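(* Let $k,n,m$ be positive integers with $k<n$ and $m\ge2$, let $K$ be a field, let $V$ be a $K$-vector space of dimension $k$, let $J:=\{1,\dots,n\}$, and let $v:J\to V$, $i\mapsto v_i$, be a map with $\langle v_1,\dots,v_n\rangle=V$. Let $T$ be an $N$-system of elements of $J$ for some $N\ge mk+1$ which has good decompositions. Then all its good decompositions are equivalent.
   Context: Systems: for a nonempty set $\mathcal{A}$, a system of elements of $\mathcal{A}$ is an element $T=\sum_{a\in\mathcal{A}}T(a)\cdot[a]$ of $\mathbb{Z}_{\ge0}[\mathcal{A}]$, i.e. a finitely supported function $T:\mathcal{A}\to\mathbb{Z}_{\ge0}$ (a finite multiset); $|T|:=\sum_aT(a)$; $T$ is an $N$-system if $|T|=N$; $\mathrm{supp}\,T:=\{a: T(a)>0\}$. Systems are added pointwise. A system $R$ of elements of $V$ is a basis of $V$ if $\mathrm{supp}\,R$ spans $V$ and $|R|=k$. A system $T$ of elements of $J$ induces the system $v^{sys}(T):=\sum_{i\in J}T(i)\cdot[v_i]$ of elements of $V$. Strong decompositions: for $l\in\{0,1\}$, a strong decomposition of an $(mk+l)$-system $T$ of elements of $J$ is a decomposition $T=T^{(1)}+\dots+T^{(m+1)}$ into systems of elements of $J$ such that $T^{(1)},\dots,T^{(m)}$ are $k$-systems, $T^{(m+1)}$ is an $l$-system, and $v^{sys}(T^{(1)}),\dots,v^{sys}(T^{(m)})$ are bases of $V$. The $(mk+l)$-system $T$ is strong if it admits a strong decomposition. Good decompositions: a good decomposition of an $N$-system $T$ of elements of $J$ with $N\ge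 mk+1$ is a decomposition $T=T_1+T_2$ into two systems of elements of $J$ such that $T_2$ is a strong $(mk+1)$-system; it is also denoted $(T_1,T_2)$. Two good decompositions $T=T_1+T_2$ and $T=S_1+S_2$ of $T$ are locally related, $(S_1,S_2)\sim_{loc}(T_1,T_2)$, if there are strong decompositions $S_2=S_2^{(1)}+\dots+S_2^{(m+1)}$ and $T_2=T_2^{(1)}+\dots+T_2^{(m+1)}$ with $S_2^{(j)}=T_2^{(j)}$ for $1\le j\le m$. They are equivalent, $(S_1,S_2)\sim(T_1,T_2)$, if there is a finite sequence $\sigma_1,\dots,\sigma_r$ ($r\ge1$) of good decompositions of $T$ with $\sigma_1=(S_1,S_2)$, $\sigma_r=(T_1,T_2)$ and $\sigma_j\sim_{loc}\sigma_{j+1}$ for $j=1,\dots,r-1$. *)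

theory Defs
  imports Complex_Main "HOL-Library.Multiset"
begin

(* A finitely supported function A -> Z_{>=0} is a finite multiset:
   T(a) is count T a, |T| is size T, supp T is set_mset T. *)

definition system_of :: "'a set \<Rightarrow> nat \<Rightarrow> 'a multiset \<Rightarrow> bool" where
  "system_of A N T \<longleftrightarrow> set_mset T \<subseteq> A \<and> size T = N"

(* The vector space V is the whole type 'v, with scalar multiplication scale. *)
definition basis_system ::
  "('f::field \<Rightarrow> 'v::ab_group_add \<Rightarrow> 'v) \<Rightarrow> 'v multiset \<Rightarrow> bool" where
  "basis_system scale R \<longleftrightarrow>
     module.span scale (set_mset R) = UNIV \<and> size R = vector_space.dim scale UNIV"

definition v_sys :: "('i \<Rightarrow> 'v) \<Rightarrow> 'i multiset \<Rightarrow> 'v multiset" where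
  "v_sys v T = image_mset v T"

(* In the following definitions k is dim V. Only the values D 1, ..., D (m + 1) matter. *)
definition strong_decomposition ::
  "('f::field \<Rightarrow> 'v::ab_group_add \<Rightarrow> 'v) \<Rightarrow> 'i set \<Rightarrow> ('i \<Rightarrow> 'v) \<Rightarrow> nat \<Rightarrow> nat \<Rightarrow>
     nat \<Rightarrow> 'i multiset \<Rightarrow> (nat \<Rightarrow> 'i multiset) \<Rightarrow> bool" where
  "strong_decomposition scale J v k m l T D \<longleftrightarrow>
     T = (\<Sum>j = 1..m + 1. D j) \<and>
     (\<forall>j\<in>{1..m}. system_of J k (D j)) \<and>
     system_of J l (D (m + 1)) \<and>
     (\<forall>j\<in>{1..m}. basis_system scale (v_sys v (D j)))"

definition strong ::
  "('f::field \<Rightarrow> 'v::ab_group_add \<Rightarrow> 'v) \<Rightarrow> 'i set \<Rightarrow> ('i \<Rightarrow> 'v) \<Rightarrow> nat \<Rightarrow> nat \<Rightarrow>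
     nat \<Rightarrow> 'i multiset \<Rightarrow> bool" where
  "strong scale J v k m l T \<longleftrightarrow>
     system_of J (m * k + l) T \<and> (\<exists>D. strong_decomposition scale J v k m l T D)"

definition good_decomposition ::
  "('f::field \<Rightarrow> 'v::ab_group_add \<Rightarrow> 'v) \<Rightarrow> 'i set \<Rightarrow> ('i \<Rightarrow> 'v) \<Rightarrow> nat \<Rightarrow> nat \<Rightarrow>
     'i multiset \<Rightarrow> 'i multiset \<times> 'i multiset \<Rightarrow> bool" where
  "good_decomposition scale J v k m T \<sigma> \<longleftrightarrow>
     T = fst \<sigma> + snd \<sigma> \<and> set_mset (fst \<sigma>) \<subseteq> J \<and> strong scale J v k m 1 (snd \<sigma>)"

definition locally_related ::
  "('f::field \<Rightarrow> 'v::ab_group_add \<Rightarrow> 'v) \<Rightarrow> 'i set \<Rightarrow> ('i \<Rightarrow> 'v) \<Rightarrow> nat \<Rightarrow> nat \<Rightarrow>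
     'i multiset \<Rightarrow> 'i multiset \<times> 'i multiset \<Rightarrow> 'i multiset \<times> 'i multiset \<Rightarrow> bool" where
  "locally_related scale J v k m T \<sigma> \<tau> \<longleftrightarrow>
     good_decomposition scale J v k m T \<sigma> \<and>
     good_decomposition scale J v k m T \<tau> \<and>
     (\<exists>D E. strong_decomposition scale J v k m 1 (snd \<sigma>) D \<and>
            strong_decomposition scale J v k m 1 (snd \<tau>) E \<and>
            (\<forall>j\<in>{1..m}. D j = E j))"

definition equivalent ::
  "('f::field \<Rightarrow> 'v::ab_group_add \<Rightarrow> 'v) \<Rightarrow> 'i set \<Rightarrow> ('i \<Rightarrow> 'v) \<Rightarrow> nat \<Rightarrow> nat \<Rightarrow>
     'i multiset \<Rightarrow> 'i multiset \<times> 'i multiset \<Rightarrow> 'i multiset \<times> 'i multiset \<Rightarrow> bool" where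
  "equivalent scale J v k m T \<sigma> \<tau> \<longleftrightarrow>
     (\<exists>s. s \<noteq> [] \<and> (\<forall>\<rho>\<in>set s. good_decomposition scale J v k m T \<rho>) \<and>
          hd s = \<sigma> \<and> last s = \<tau> \<and>
          (\<forall>j. Suc j < length s \<longrightarrow> locally_related scale J v k m T (s ! j) (s ! Suc j)))"

end

(* Only the bases of the m-fold union of the matroid represented by v matter: a good decomposition
   consists of a basis B of that union inside T and one further element, two good decompositions
   sharing such a B are locally related, and any two bases are joined by single exchanges. For an
   exchange from B to B - x + y, the system B + y contains both bases, so that the corresponding
   good decompositions are linked. The exchange property is that of matroid unions. *)

theory Submission
  imports Defs
begin

section \<open>Unions of augmentable families of multisets\<close>

lemma sum_upd:
  fixes f :: "'i \<Rightarrow> 'b::comm_monoid_add"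
  assumes "finite A" "i \<in> A"
  shows "sum (f(i := b)) A = b + sum f (A - {i})"
  using assms by (simp add: sum.remove)

lemma sum_eq_remove2:
  fixes f :: "'i \<Rightarrow> 'b::comm_monoid_add"
  assumes "finite A" "i \<in> A" "l \<in> A" "i \<noteq> l"
  shows "sum f A = f i + (f l + sum f (A - {i, l}))"
proof -
  have "A - {i} - {l} = A - {i, l}" by auto
  then show ?thesis
    using assms sum.remove[of A i f] sum.remove[of "A - {i}" l f] by simp
qed

text \<open>This is the augmentation step of matroid union. Some \<open>I i\<close> is smaller than
  \<open>J i\<close> and can be augmented by an \<open>x\<close> from \<open>J i\<close>. If
  \<open>x\<close> is not surplus in \<open>sum J A\<close>, another component \<open>I l\<close>
  has too many copies of \<open>x\<close>; shifting one to \<open>I i\<close> brings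
  \<open>I\<close> closer to \<open>J\<close>, and the total overlap is bounded by
  \<open>size (sum J A)\<close>.\<close>

lemma augment_union:
  fixes I J :: "'i \<Rightarrow> 'a multiset"
  assumes mono: "\<And>R S. indep R \<Longrightarrow> S \<subseteq># R \<Longrightarrow> indep S"
    and augment: "\<And>R S. indep R \<Longrightarrow> indep S \<Longrightarrow> size R < size S \<Longrightarrow>
          \<exists>x. x \<in># S \<and> x \<notin># R \<and> indep (add_mset x R)"
    and A: "finite A"
    and J: "\<forall>j\<in>A. indep (J j)"
  shows "\<lbrakk>\<forall>j\<in>A. indep (I j); size (sum I A) < size (sum J A)\<rbrakk> \<Longrightarrow>
      \<exists>x I'. x \<in># sum J A - sum I A \<and> (\<forall>j\<in>A. indep (I' j)) \<and> sum I' A = add_mset x (sum I A)"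
proof (induction "size (sum J A) - (\<Sum>j\<in>A. size (I j \<inter># J j))" arbitrary: I rule: less_induct)
  case less
  have "(\<Sum>j\<in>A. size (I j)) < (\<Sum>j\<in>A. size (J j))"
    using less.prems(2) by simp
  then obtain i where i: "i \<in> A" "size (I i) < size (J i)"
    by (meson not_le sum_mono)
  then obtain x where x: "x \<in># J i" "x \<notin># I i" "indep (add_mset x (I i))"
    using augment less.prems(1) J by blast
  show ?case
  proof (cases "x \<in># sum J A - sum I A")
    case True
    have "sum (I(i := add_mset x (I i))) A = add_mset x (sum I A)"
      using A i(1) by (simp add: sum_upd sum.remove[of A i I] del: fun_upd_apply)
    moreover have "\<forall>j\<in>A. indep ((I(i := add_mset x (I i))) j)"
      using less.prems(1) x(3) by simp
    ultimately show ?thesis using True by blast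
  next
    case False
    \<comment> \<open>The deficit of \<open>x\<close> at \<open>i\<close> must be made up elsewhere,
      which produces \<open>l\<close>.\<close>
    then have "(\<Sum>j\<in>A. count (J j) x) \<le> (\<Sum>j\<in>A. count (I j) x)"
      by (simp add: in_diff_count count_sum not_less)
    moreover have "count (I i) x < count (J i) x" using x by (simp add: not_in_iff)
    ultimately have "\<exists>l\<in>A. count (J l) x < count (I l) x"
      using sum_strict_mono_ex1[of A "\<lambda>j. count (I j) x" "\<lambda>j. count (J j) x"] A i(1)
      by (meson not_le)
    then obtain l where l: "l \<in> A" "count (J l) x < count (I l) x" by blast
    have ne: "i \<noteq> l" using l(2) \<open>count (I i) x < count (J i) x\<close> by auto
    have xl: "x \<in># I l" using l(2) by (intro count_inI) simp
    \<comment> \<open>Moving x from I l to I i keeps the sum but increases the total overlap with J.\<close>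
    define I' where "I' = I(i := add_mset x (I i), l := I l - {#x#})"
    have sumI': "sum I' A = sum I A"
      unfolding sum_eq_remove2[OF A i(1) l(1) ne] using ne xl
      by (simp add: I'_def union_assoc[symmetric] multiset_eq_iff)
    have indep': "\<forall>j\<in>A. indep (I' j)"
      using less.prems(1) x(3) l(1) ne mono[OF _ diff_subset_eq_self] by (auto simp: I'_def)
    have eq_i: "size (I' i \<inter># J i) = Suc (size (I i \<inter># J i))"
    proof -
      have "I' i \<inter># J i = add_mset x (I i \<inter># J i)"
        using x ne by (auto simp: I'_def multiset_eq_iff not_in_iff)
      then show ?thesis by simp
    qed
    \<comment> \<open>The copy of \<open>x\<close> taken from \<open>I l\<close> exceeds the
      multiplicity in \<open>J l\<close>, so no overlap is lost.\<close>
    have eq_l: "I' l \<inter># J l = I l \<inter># J l"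
      using l(2) by (auto simp: I'_def multiset_eq_iff)
    have "(\<Sum>j\<in>A. size (I' j \<inter># J j)) = Suc (\<Sum>j\<in>A. size (I j \<inter># J j))"
      unfolding sum_eq_remove2[OF A i(1) l(1) ne] eq_i eq_l by (simp add: I'_def)
    moreover have "(\<Sum>j\<in>A. size (I' j \<inter># J j)) \<le> size (sum J A)"
      by (auto intro!: sum_mono size_mset_mono)
    ultimately have "size (sum J A) - (\<Sum>j\<in>A. size (I' j \<inter># J j))
        < size (sum J A) - (\<Sum>j\<in>A. size (I j \<inter># J j))"
      by linarith
    from less.hyps[OF this indep'] show ?thesis
      using less.prems(2) sumI' by simp
  qed
qed

section \<open>Linearly independent systems\<close>

text \<open>The cardinality condition forces multiplicities one and injectivity of \<open>v\<close>
  on the support. These are the independent sets of the matroid represented by \<open>v\<close>,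
  written as multisets.\<close>

definition indep_system ::
  "('f::field \<Rightarrow> 'v::ab_group_add \<Rightarrow> 'v) \<Rightarrow> ('i \<Rightarrow> 'v) \<Rightarrow> 'i multiset \<Rightarrow> bool" where
  "indep_system scale v R \<longleftrightarrow>
     \<not> module.dependent scale (v ` set_mset R) \<and> card (v ` set_mset R) = size R"

lemma card_image_set_mset_le: "card (v ` set_mset R) \<le> size R"
proof (induction R)
  case (add x R)
  then show ?case using card_insert_le_m1[of "Suc (size R)" "v ` set_mset R" "v x"] by simp
qed simp

text \<open>The part removed from \<open>R\<close> accounts for at most as many distinct vectors as
  its size, so those of \<open>S\<close> must still be \<open>size S\<close> in number.\<close>

lemma (in vector_space) indep_system_mono:
  assumes "indep_system scale v R" "S \<subseteq># R"
  shows "indep_system scale v S"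
proof -
  obtain U where R: "R = S + U" using assms(2) by (auto simp: subset_mset.le_iff_add)
  have "card (v ` set_mset R) \<le> card (v ` set_mset S) + card (v ` set_mset U)"
    unfolding R set_mset_union image_Un by (rule card_Un_le)
  then have "card (v ` set_mset S) = size S"
    using card_image_set_mset_le[of v S] card_image_set_mset_le[of v U] assms(1) by (simp add: R indep_system_def)
  moreover have "independent (v ` set_mset S)"
    using assms(1) by (auto simp: R indep_system_def image_Un dest: dependent_mono[of "v ` set_mset S" "v ` set_mset S \<union> v ` set_mset U"])
  ultimately show ?thesis by (simp add: indep_system_def)
qed

text \<open>By Steinitz, more than \<open>size R\<close> independent vectors cannot all lie in a
  span of \<open>size R\<close> vectors. A vector outside this span also lies outside
  \<open>R\<close>.\<close>

lemma (in vector_space) indep_system_augment: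
  assumes "indep_system scale v R" "indep_system scale v S" "size R < size S"
  shows "\<exists>x. x \<in># S \<and> x \<notin># R \<and> indep_system scale v (add_mset x R)"
proof -
  have "\<not> v ` set_mset S \<subseteq> span (v ` set_mset R)"
    using independent_span_bound[of "v ` set_mset R" "v ` set_mset S"] assms
    by (auto simp: indep_system_def)
  then obtain x where x: "x \<in># S" "v x \<notin> span (v ` set_mset R)" by blast
  then have "v x \<notin> v ` set_mset R" using span_base by blast
  then show ?thesis using x assms(1)
    by (intro exI[of _ x]) (auto simp: indep_system_def independent_insert)
qed

lemma (in finite_dimensional_vector_space) size_indep_system_le:
  "indep_system scale v R \<Longrightarrow> size R \<le> dim UNIV"
  using independent_card_le_dim[of "v ` set_mset R" UNIV] by (simp add: indep_system_def)

text \<open>A spanning set has at least \<open>dim UNIV\<close> elements, so a basis system cannot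
  repeat a vector; for sets of exactly that many vectors, spanning and independence agree.\<close>

lemma (in finite_dimensional_vector_space) basis_system_iff:
  "basis_system scale (v_sys v R) \<longleftrightarrow> indep_system scale v R \<and> size R = dim UNIV"
proof -
  let ?S = "v ` set_mset R"
  have "card ?S = dim UNIV" if "span ?S = UNIV" "size R = dim UNIV"
  proof (rule antisym)
    show "dim UNIV \<le> card ?S" using that(1) by (intro dim_le_card) auto
    show "card ?S \<le> dim UNIV"
      using that(2) card_image_set_mset_le[of v R] by simp
  qed
  then show ?thesis
    using card_eq_dim[of ?S UNIV] top_unique[of "span ?S"]
    unfolding basis_system_def v_sys_def indep_system_def set_image_mset size_image_mset
    by (metis finite_imageI finite_set_mset subset_UNIV)
qed

section \<open>Chains of good decompositions\<close>

text \<open>No index set \<open>J\<close> occurs: membership in \<open>J\<close> is later recovered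
  from containment in \<open>T\<close>.\<close>

definition union_basis ::
  "('f::field \<Rightarrow> 'v::ab_group_add \<Rightarrow> 'v) \<Rightarrow> ('i \<Rightarrow> 'v) \<Rightarrow> nat \<Rightarrow> 'i multiset \<Rightarrow> bool" where
  "union_basis scale v m B \<longleftrightarrow>
     (\<exists>D. (\<forall>j\<in>{1..m}. basis_system scale (v_sys v (D j))) \<and> B = sum D {1..m})"

lemma size_basis_system:
  "basis_system scale (v_sys v R) \<Longrightarrow> size R = vector_space.dim scale UNIV"
  by (simp add: basis_system_def v_sys_def)

lemma size_union_basis:
  "union_basis scale v m B \<Longrightarrow> size B = m * vector_space.dim scale UNIV"
  by (auto simp: union_basis_def size_basis_system[of scale v] simp del: One_nat_def)

text \<open>Deleting \<open>x\<close> from a component of \<open>B\<close> leaves an independent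
  family of smaller total size than \<open>B'\<close>, which \<open>augment_union\<close> enlarges
  by an element of \<open>B'\<close>.\<close>

lemma (in finite_dimensional_vector_space) union_basis_exchange:
  assumes B: "union_basis scale v m B" and B': "union_basis scale v m B'"
    and x: "x \<in># B - B'"
  shows "\<exists>y. y \<in># B' - B \<and> union_basis scale v m (add_mset y (B - {#x#}))"
proof -
  obtain D E where D: "\<forall>j\<in>{1..m}. basis_system scale (v_sys v (D j))" "B = sum D {1..m}"
    and E: "\<forall>j\<in>{1..m}. basis_system scale (v_sys v (E j))" "B' = sum E {1..m}"
    using B B' by (auto simp: union_basis_def)
  have xB: "x \<in># B" using x by (rule in_diffD)
  then obtain i where i: "i \<in> {1..m}" "x \<in># D i"
    unfolding D(2) by (auto simp: set_mset_sum)
  define I where "I = D(i := D i - {#x#})"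
  have sumI: "sum I {1..m} = B - {#x#}"
    using i unfolding D(2) by (simp add: I_def sum_upd sum.remove[of _ i D] del: fun_upd_apply)
  have "\<exists>y I'. y \<in># sum E {1..m} - sum I {1..m} \<and> (\<forall>j\<in>{1..m}. indep_system scale v (I' j)) \<and>
      sum I' {1..m} = add_mset y (sum I {1..m})"
  proof (rule augment_union)
    show "\<forall>j\<in>{1..m}. indep_system scale v (I j)"
    proof
      fix j assume "j \<in> {1..m}"
      then have "indep_system scale v (D j)" using D(1) basis_system_iff by blast
      moreover have "I j \<subseteq># D j" by (simp add: I_def)
      ultimately show "indep_system scale v (I j)" by (rule indep_system_mono)
    qed
    show "\<forall>j\<in>{1..m}. indep_system scale v (E j)" using E(1) basis_system_iff by blast
    show "size (sum I {1..m}) < size (sum E {1..m})"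
      using size_union_basis[OF B] size_union_basis[OF B'] xB
      unfolding sumI E(2)[symmetric] by (metis size_Diff1_less)
  qed (use indep_system_mono indep_system_augment in auto)
  then obtain y I' where y: "y \<in># B' - (B - {#x#})"
      and I': "\<forall>j\<in>{1..m}. indep_system scale v (I' j)"
        "sum I' {1..m} = add_mset y (B - {#x#})"
    unfolding sumI E(2)[symmetric] by blast
  \<comment> \<open>No component exceeds the dimension and the sizes add up to
    \<open>m * dim UNIV\<close>, so each bound is attained.\<close>
  have "size (I' j) = dim UNIV" if j: "j \<in> {1..m}" for j
  proof (rule ccontr)
    assume "size (I' j) \<noteq> dim UNIV"
    moreover have le: "size (I' i) \<le> dim UNIV" if "i \<in> {1..m}" for i
      using size_indep_system_le I'(1) that by blast
    ultimately have "size (I' j) < dim UNIV" using le[OF j] by linarith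
    then have "(\<Sum>j=1..m. size (I' j)) < (\<Sum>j=1..m. dim UNIV)"
      using le j by (intro sum_strict_mono_ex1) blast+
    moreover have "(\<Sum>j=1..m. size (I' j)) = m * dim UNIV"
      using arg_cong[OF I'(2), of size] size_union_basis[OF B] xB
      by (metis insert_DiffM size_add_mset size_multiset_sum)
    ultimately show False by simp
  qed
  then have "\<forall>j\<in>{1..m}. basis_system scale (v_sys v (I' j))"
    using I'(1) basis_system_iff by blast
  then have "union_basis scale v m (add_mset y (B - {#x#}))"
    unfolding union_basis_def I'(2)[symmetric] by blast
  \<comment> \<open>The case \<open>y = x\<close> is impossible: even after losing one
    \<open>x\<close>, \<open>B\<close> has at least as many copies of it as
    \<open>B'\<close>.\<close>
  moreover have "y \<in># B' - B"
    using x y by (cases "y = x") (auto simp: in_diff_count)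
  ultimately show ?thesis by blast
qed

text \<open>For \<open>l = 1\<close> the last summand is a single element \<open>x\<close>, and the
  first component is whatever remains of \<open>T\<close>.\<close>

lemma good_decompositionD:
  assumes "good_decomposition scale J v k m T \<sigma>"
  obtains B x where "union_basis scale v m B" "add_mset x B \<subseteq># T"
    "\<sigma> = (T - add_mset x B, add_mset x B)"
proof -
  obtain D where D: "strong_decomposition scale J v k m 1 (snd \<sigma>) D"
    using assms by (auto simp: good_decomposition_def strong_def)
  then have "size (D (m + 1)) = 1"
    by (simp add: strong_decomposition_def system_of_def)
  then obtain x where x: "D (m + 1) = {#x#}" using size_1_singleton_mset by blast
  define B where "B = sum D {1..m}"
  have "snd \<sigma> = add_mset x B"
    using D x by (simp add: strong_decomposition_def B_def)
  moreover have "union_basis scale v m B"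
    using D by (auto simp: union_basis_def strong_decomposition_def B_def)
  moreover have "T = fst \<sigma> + snd \<sigma>"
    using assms by (simp add: good_decomposition_def)
  ultimately show ?thesis
    by (intro that[of B x]) (auto simp: prod_eq_iff)
qed

lemma strong_decomposition_add_mset:
  assumes "\<forall>j\<in>{1..m}. basis_system scale (v_sys v (D j))"
    and "vector_space.dim scale (UNIV :: 'v::ab_group_add set) = k"
    and "set_mset (add_mset x (sum D {1..m})) \<subseteq> J"
  shows "strong_decomposition scale J (v :: _ \<Rightarrow> 'v) k m 1 (add_mset x (sum D {1..m}))
           (D(m + 1 := {#x#}))"
proof -
  have "set_mset (D j) \<subseteq> J" if "j \<in> {1..m}" for j
    using assms(3) that by (force simp: set_mset_sum)
  then show ?thesis
    using assms size_basis_system[of scale v]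
    by (auto simp: strong_decomposition_def system_of_def)
qed

text \<open>One family \<open>D\<close> of bases serves both sides; only its value at
  \<open>m + 1\<close> is set to \<open>{#x#}\<close> or \<open>{#y#}\<close>.\<close>

lemma locally_related_add_mset:
  assumes B: "union_basis scale v m B"
    and dim: "vector_space.dim scale (UNIV :: 'v::ab_group_add set) = k"
    and T: "set_mset T \<subseteq> J"
    and sub: "add_mset x B \<subseteq># T" "add_mset y B \<subseteq># T"
  shows "locally_related scale J (v :: _ \<Rightarrow> 'v) k m T
           (T - add_mset x B, add_mset x B) (T - add_mset y B, add_mset y B)"
proof -
  obtain D where D: "\<forall>j\<in>{1..m}. basis_system scale (v_sys v (D j))" "B = sum D {1..m}"
    using B by (auto simp: union_basis_def)
  have in_J: "set_mset (add_mset z B) \<subseteq> J" if "add_mset z B \<subseteq># T" for z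
    using set_mset_mono[OF that] T by blast
  have sd: "strong_decomposition scale J v k m 1 (add_mset z B) (D(m + 1 := {#z#}))"
    if "add_mset z B \<subseteq># T" for z
    using strong_decomposition_add_mset[OF D(1) dim] in_J[OF that] unfolding D(2) by blast
  have good: "good_decomposition scale J v k m T (T - add_mset z B, add_mset z B)"
    if z: "add_mset z B \<subseteq># T" for z
  proof -
    have "size (add_mset z B) = m * k + 1" using size_union_basis[OF B] dim by simp
    then have "strong scale J v k m 1 (add_mset z B)"
      using sd[OF z] in_J[OF z] by (auto simp: strong_def system_of_def)
    moreover have "set_mset (T - add_mset z B) \<subseteq> J" using T by (auto dest: in_diffD)
    ultimately show ?thesis
      using subset_mset.diff_add[OF z] unfolding good_decomposition_def fst_conv snd_conv by metis
  qed
  have "\<forall>j\<in>{1..m}. (D(m + 1 := {#x#})) j = (D(m + 1 := {#y#})) j" by simp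
  then show ?thesis
    unfolding locally_related_def snd_conv using good sd sub by blast
qed

text \<open>The reflexive case of the closure says nothing about goodness, so the one-element list
  takes it from the hypothesis on \<open>\<tau>\<close>.\<close>

lemma rtranclp_locally_related_imp_equivalent:
  assumes "(locally_related scale J v k m T)\<^sup>*\<^sup>* \<sigma> \<tau>" "good_decomposition scale J v k m T \<tau>"
  shows "equivalent scale J v k m T \<sigma> \<tau>"
  using assms
proof (induction rule: converse_rtranclp_induct)
  case base
  then show ?case by (auto simp: equivalent_def intro!: exI[of _ "[\<tau>]"])
next
  case (step \<sigma> \<rho>)
  then obtain s where s: "s \<noteq> []" "\<forall>\<rho>\<in>set s. good_decomposition scale J v k m T \<rho>"
    "hd s = \<rho>" "last s = \<tau>"
    "\<forall>j. Suc j < length s \<longrightarrow> locally_related scale J v k m T (s ! j) (s ! Suc j)"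
    by (auto simp: equivalent_def)
  have "locally_related scale J v k m T ((\<sigma> # s) ! j) ((\<sigma> # s) ! Suc j)"
    if "Suc j < length (\<sigma> # s)" for j
    using that s step.hyps(1) by (cases j) (auto simp: hd_conv_nth)
  then show ?case
    using s step.hyps(1) unfolding equivalent_def
    by (intro exI[of _ "\<sigma> # s"]) (auto simp: locally_related_def)
qed

lemma (in finite_dimensional_vector_space) locally_related_chain:
  assumes dim: "dim UNIV = k"
    and T: "set_mset T \<subseteq> J"
    and B': "union_basis scale v m B'" "add_mset y B' \<subseteq># T"
  shows "\<lbrakk>union_basis scale v m B; add_mset x B \<subseteq># T\<rbrakk> \<Longrightarrow>
    (locally_related scale J v k m T)\<^sup>*\<^sup>*
      (T - add_mset x B, add_mset x B) (T - add_mset y B', add_mset y B')"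
proof (induction "size (B' - B)" arbitrary: B x rule: less_induct)
  case less
  have sizes: "size B = size B'"
    using size_union_basis[OF less.prems(1)] size_union_basis[OF B'(1)] by simp
  show ?case
  proof (cases "B - B' = {#}")
    case True
    then have "B = B'"
      using sizes
      by (metis Diff_eq_empty_iff_mset less_irrefl mset_subset_size subset_mset.le_less)
    then show ?thesis
      \<comment> \<open>With equal bases, a single local step replaces \<open>x\<close> by
        \<open>y\<close>.\<close>
      using locally_related_add_mset[OF B'(1) dim T] less.prems(2) B'(2) by blast
  next
    case False
    then obtain x' where x': "x' \<in># B - B'" by blast
    then obtain y' where y': "y' \<in># B' - B"
      and B'': "union_basis scale v m (add_mset y' (B - {#x'#}))" (is "union_basis _ _ _ ?B")
      using union_basis_exchange[OF less.prems(1) B'(1)] by blast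
    \<comment> \<open>This one system is read both as \<open>B\<close> with extra element
      \<open>y'\<close> and as \<open>?B\<close> with extra element \<open>x'\<close>.\<close>
    have eq: "add_mset x' ?B = add_mset y' B"
      using in_diffD[OF x'] by (simp add: add_mset_commute)
    \<comment> \<open>At \<open>y'\<close> the count is bounded by that of \<open>B'\<close>,
      elsewhere by that of \<open>B\<close>; both systems lie in \<open>T\<close>.\<close>
    have sub: "add_mset y' B \<subseteq># T"
    proof (rule mset_subset_eqI)
      fix a
      show "count (add_mset y' B) a \<le> count T a"
        using mset_subset_eq_count[OF less.prems(2), of a] mset_subset_eq_count[OF B'(2), of a] y'
        by (auto simp: in_diff_count split: if_splits)
    qed
    have "B' - ?B = B' - B - {#y'#}"
      using x' y' by (auto simp: multiset_eq_iff in_diff_count)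
    then have "size (B' - ?B) < size (B' - B)"
      using y' by (metis size_Diff1_less)
    \<comment> \<open>The chain first trades \<open>x\<close> for \<open>y'\<close> over
      \<open>B\<close>, then continues from \<open>?B\<close> with extra element
      \<open>x'\<close>.\<close>
    from less.hyps[OF this B'', of x'] sub
    show ?thesis
      using locally_related_add_mset[OF less.prems(1) dim T less.prems(2) sub]
      unfolding eq by (meson converse_rtranclp_into_rtranclp)
  qed
qed

theorem theorem3p2:
  fixes scale :: "'f::field \<Rightarrow> 'v::ab_group_add \<Rightarrow> 'v"
    and k n m N :: nat
    and v :: "nat \<Rightarrow> 'v"
    and T :: "nat multiset"
  assumes "vector_space scale"
    and "0 < k" and "k < n" and "2 \<le> m"
    and "vector_space.dim scale (UNIV :: 'v set) = k"
    and "module.span scale (v ` {1..n}) = UNIV"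
    and "m * k + 1 \<le> N"
    and "system_of {1..n} N T"
    and "\<exists>\<sigma>. good_decomposition scale {1..n} v k m T \<sigma>"
  shows "\<forall>\<sigma> \<tau>. good_decomposition scale {1..n} v k m T \<sigma> \<longrightarrow>
                good_decomposition scale {1..n} v k m T \<tau> \<longrightarrow>
                equivalent scale {1..n} v k m T \<sigma> \<tau>"
proof (intro allI impI)
  fix \<sigma> \<tau>
  assume \<sigma>: "good_decomposition scale {1..n} v k m T \<sigma>"
    and \<tau>: "good_decomposition scale {1..n} v k m T \<tau>"
  have T: "set_mset T \<subseteq> {1..n}" using assms(8) by (simp add: system_of_def)
  obtain B x where B: "union_basis scale v m B" "add_mset x B \<subseteq># T"
      "\<sigma> = (T - add_mset x B, add_mset x B)"
    using good_decompositionD[OF \<sigma>] .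
  obtain B' y where B': "union_basis scale v m B'" "add_mset y B' \<subseteq># T"
      "\<tau> = (T - add_mset y B', add_mset y B')"
    using good_decompositionD[OF \<tau>] .
  interpret vector_space scale by (rule assms(1))
  \<comment> \<open>A maximal independent subset of the finitely many spanning vectors is the finite
    basis that the finite-dimensional locale takes as parameter.\<close>
  obtain C where C: "C \<subseteq> v ` {1..n}" "independent C" "v ` {1..n} \<subseteq> span C"
    using maximal_independent_subset .
  have "finite C" using C(1) by (rule finite_subset) simp
  moreover have "span C = UNIV" using span_minimal[OF C(3) subspace_span] assms(6) by auto
  ultimately interpret finite_dimensional_vector_space scale C
    using C(2) by unfold_locales
  have "(locally_related scale {1..n} v k m T)\<^sup>*\<^sup>* \<sigma> \<tau>"
    using locally_related_chain[OF assms(5) T B'(1,2) B(1,2)] B(3) B'(3) by simp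
  then show "equivalent scale {1..n} v k m T \<sigma> \<tau>"
    using \<tau> by (rule rtranclp_locally_related_imp_equivalent)
qed

end
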